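(* Let $(X,T)$ be a topological dynamical system. Then the following assertions are equivalent: (1) $(X,T)$ is uniquely ergodic; (2) there exists $\mu\in M_T(X)$ such that for any $f\in C(X,\mathbb{R})$ and $x\in X$ one has $$\lim_{n-m\to\infty}\frac{1}{H_{n-m}}\sum_{k=m+1}^n\frac{1}{k-m}f(T^{k-1}x)=\int f\,\mathrm{d}\mu;$$ (3) there exists $\mu\in M_T(X)$ such that for any $f\in C(X,\mathbb{R})$ and $x\in X$ one has $$\lim_{n\to\infty}\frac{1}{H_n}\sum_{k=1}^n\frac1k f(T^{k-1}x)=\int f\,\mathrm{d}\mu;$$ (4) for any $f\in C(X,\mathbb{R})$ the functions $\frac{1}{H_n}\sum_{k=1}^n\frac1k f\circ T^{k-1}$ converge pointwise on $X$ to a constant function as $n\to\infty$; (5) for any $f\in C(X,\mathbb{R})$ the functions $\frac{1}{H_{n-m}}\sum_{k=m+1}^n\frac{1}{k-m}f\circ T^{k-1}$ converge pointwise on $X$ to a constant function as $n-m\to\infty$; (6) for any $f\in C(X,\mathbb{R})$ the functions $\frac{1}{H_n}\sum_{k=1}^n\frac1k f\circ T^{k-1}$ converge uniformly on $X$ to a constant function as $n\to\infty$; (7) for any $f\in C(X,\mathbb{R})$ the functions $\frac{1}{H_{n-m}}\sum_{k=m+1}^n\frac{1}{k-m}f\circ T^{k-1}$ converge uniformly on $X$ to a constant function as $n-m\to\infty$.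
   Context: A topological dynamical system is a pair $(X,T)$ where $(X,d)$ is a nonempty compact metric space and $T\colon X\to X$ is a continuous map. $C(X,\mathbb{R})$ is the space of continuous real-valued functions on $X$. $M_T(X)$ is the set of $T$-invariant Borel probability measures on $X$. $(X,T)$ is uniquely ergodic if $M_T(X)$ is a singleton. $H_n=\sum_{k=1}^n\frac1k$. Limits as $n-m\to\infty$ are over pairs of integers $n>m\ge 0$: $a_{m,n}\to a$ as $n-m\to\infty$ means that for every $\varepsilon>0$ there is $N$ such that $|a_{m,n}-a|<\varepsilon$ for all $n>m\ge0$ with $n-m\ge N$ (for uniform convergence of functions, use the supremum norm). In (4)–(7) the constant may depend on $f$. *)

theory Defs
  imports "HOL-Probability.Probability"
begin

locale topological_dynamical_system =
  fixes X :: "'a::metric_space set" and T :: "'a \<Rightarrow> 'a"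
  assumes nonempty: "X \<noteq> {}"
    and compact: "compact X"
    and continuous: "continuous_on X T"
    and maps_into: "T \<in> X \<rightarrow> X"

(* Borel measures on X are measures on the subspace sigma-algebra, so their space is X itself. *)
definition invariant_prob_measures :: "'a::metric_space set \<Rightarrow> ('a \<Rightarrow> 'a) \<Rightarrow> 'a measure set" where
  "invariant_prob_measures X T =
     {\<mu>. sets \<mu> = sets (restrict_space borel X) \<and> prob_space \<mu> \<and>
         (\<forall>A\<in>sets \<mu>. emeasure \<mu> (T -` A \<inter> X) = emeasure \<mu> A)}"

definition uniquely_ergodic :: "'a::metric_space set \<Rightarrow> ('a \<Rightarrow> 'a) \<Rightarrow> bool" where
  "uniquely_ergodic X T \<longleftrightarrow> is_singleton (invariant_prob_measures X T)"

definition log_average :: "('a \<Rightarrow> 'a) \<Rightarrow> ('a \<Rightarrow> real) \<Rightarrow> nat \<Rightarrow> 'a \<Rightarrow> real" where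
  "log_average T f n x = 1 / harm n * (\<Sum>k=1..n. 1 / real k * f ((T ^^ (k - 1)) x))"

definition log_window_average :: "('a \<Rightarrow> 'a) \<Rightarrow> ('a \<Rightarrow> real) \<Rightarrow> nat \<Rightarrow> nat \<Rightarrow> 'a \<Rightarrow> real" where
  "log_window_average T f m n x =
     1 / harm (n - m) * (\<Sum>k=m+1..n. 1 / real (k - m) * f ((T ^^ (k - 1)) x))"

(* The filter on pairs (m, n) with m < n along which n - m tends to infinity,
   with no condition on how m itself behaves. *)
definition gap_at_top :: "(nat \<times> nat) filter" where
  "gap_at_top = inf (filtercomap (\<lambda>(m, n). n - m) at_top) (principal {(m, n). m < n})"

lemma eventually_gap_at_top:
  "eventually P gap_at_top \<longleftrightarrow> (\<exists>N. \<forall>m n. m < n \<and> N \<le> n - m \<longrightarrow> P (m, n))"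
  unfolding gap_at_top_def eventually_inf_principal eventually_filtercomap_at_top_linorder
  by (auto simp: case_prod_beta)

lemma tendsto_gap_at_top_iff:
  fixes a :: "nat \<Rightarrow> nat \<Rightarrow> real"
  shows "((\<lambda>(m, n). a m n) \<longlongrightarrow> l) gap_at_top \<longleftrightarrow>
    (\<forall>\<epsilon>>0. \<exists>N. \<forall>m n. m < n \<and> N \<le> n - m \<longrightarrow> \<bar>a m n - l\<bar> < \<epsilon>)"
  by (simp add: tendsto_iff eventually_gap_at_top dist_real_def)

end

theory Submission
  imports Defs
begin

text \<open>
  Since the window average over \<open>(m, n]\<close> at \<open>x\<close> is the logarithmic average of length \<open>n - m\<close> at
  \<open>T\<^sup>m x\<close>, uniform convergence of the plain averages gives uniform convergence of the window averages,
  and the pointwise plain statement (4) is the weakest of all. It remains to link (4) and (6) with (1).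

  Logarithmic averages are almost \<open>T\<close>-invariant, with error \<open>2 \<parallel>f\<parallel> / H\<^sub>n\<close>. So for any lengths
  \<open>N\<^sub>i \<longlongrightarrow> \<infinity>\<close> and base points \<open>x\<^sub>i\<close>, a cluster point of the functionals
  \<open>f \<mapsto> log_average T f N\<^sub>i x\<^sub>i\<close> is an invariant positive functional, hence by Riesz integration against
  an invariant measure. This yields existence of invariant measures, and, when uniform convergence
  fails, an invariant measure different from the given one. Conversely, if the averages of \<open>f\<close> converge
  pointwise to a constant \<open>c\<close>, dominated convergence gives \<open>\<integral> f \<partial>\<mu> = c\<close> for every invariant \<open>\<mu>\<close>.
\<close>

subsection \<open>Riesz representation on compact metric spaces\<close>

locale positive_functional =
  fixes X :: "'a::metric_space set" and L :: "('a \<Rightarrow> real) \<Rightarrow> real"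
  assumes compact_X: "compact X"
    and L_add: "\<lbrakk>continuous_on X f; continuous_on X g\<rbrakk> \<Longrightarrow> L (\<lambda>x. f x + g x) = L f + L g"
    and L_cmult: "continuous_on X f \<Longrightarrow> L (\<lambda>x. c * f x) = c * L f"
    and L_mono: "\<lbrakk>continuous_on X f; continuous_on X g; \<And>x. x \<in> X \<Longrightarrow> f x \<le> g x\<rbrakk> \<Longrightarrow> L f \<le> L g"
    and L_one: "L (\<lambda>x. 1) = 1"
begin

lemma L_const: "L (\<lambda>x. c) = c"
  using L_cmult[of "\<lambda>x. 1" c] L_one by simp

lemma L_cong:
  assumes "continuous_on X f" "\<And>x. x \<in> X \<Longrightarrow> f x = g x"
  shows "L f = L g"
proof -
  have "continuous_on X g" using assms continuous_on_cong by metis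
  with assms show ?thesis by (intro antisym L_mono) auto
qed

lemma L_nonneg: "\<lbrakk>continuous_on X f; \<And>x. x \<in> X \<Longrightarrow> 0 \<le> f x\<rbrakk> \<Longrightarrow> 0 \<le> L f"
  using L_mono[of "\<lambda>x. 0" f] L_const[of 0] by simp

lemma L_sum:
  assumes "finite I" "\<And>i. i \<in> I \<Longrightarrow> continuous_on X (f i)"
  shows "L (\<lambda>x. \<Sum>i\<in>I. f i x) = (\<Sum>i\<in>I. L (f i))"
  using assms
  by (induction I rule: finite_induct) (simp_all add: L_const L_add continuous_on_sum)

section \<open>An outer measure from countable continuous covers\<close>

definition covers :: "'a set \<Rightarrow> (nat \<Rightarrow> 'a \<Rightarrow> real) set" where
  "covers A = {f. (\<forall>i. continuous_on X (f i)) \<and> (\<forall>i. \<forall>x\<in>X. 0 \<le> f i x) \<and>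
    (\<forall>x\<in>A. 1 \<le> (\<Sum>i. ennreal (f i x)))}"

text \<open>This is the Daniell upper integral of the indicator of \<open>A\<close>. Admitting
  countable sums of continuous functions, not just single ones, is what makes it countably
  subadditive.\<close>

definition cover_measure :: "'a set \<Rightarrow> ennreal" where
  "cover_measure A = (INF f\<in>covers A. \<Sum>i. ennreal (L (f i)))"

lemma cover_measure_mono: "A \<subseteq> B \<Longrightarrow> cover_measure A \<le> cover_measure B"
  unfolding cover_measure_def by (rule INF_superset_mono) (auto simp: covers_def)

lemma cover_measure_le:
  assumes "continuous_on X f" "\<And>x. x \<in> X \<Longrightarrow> 0 \<le> f x" "\<And>x. x \<in> A \<Longrightarrow> 1 \<le> f x"
  shows "cover_measure A \<le> ennreal (L f)"
proof -
  let ?F = "\<lambda>i::nat. if i = 0 then f else (\<lambda>x. 0)"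
  have s: "(\<Sum>i. ennreal (?F i x)) = ennreal (f x)" for x
    by (subst suminf_finite[of "{0}"]) auto
  have "?F \<in> covers A"
    using assms by (auto simp: covers_def s)
  then have "cover_measure A \<le> (\<Sum>i. ennreal (L (?F i)))"
    unfolding cover_measure_def by (rule INF_lower)
  also have "\<dots> = ennreal (L f)"
    by (subst suminf_finite[of "{0}"]) (auto simp: L_const)
  finally show ?thesis .
qed

lemma cover_measure_empty: "cover_measure {} = 0"
  using cover_measure_le[of "\<lambda>x. 0" "{}"] by (simp add: L_const)

text \<open>A cover may be indexed by pairs: \<open>prod_decode\<close> turns the double family into
  one sequence, and in \<open>ennreal\<close> the order of summation is irrelevant.\<close>

lemma cover_measure_double:
  fixes f :: "nat \<Rightarrow> nat \<Rightarrow> 'a \<Rightarrow> real"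
  assumes "\<And>m n. continuous_on X (f m n)" "\<And>m n x. x \<in> X \<Longrightarrow> 0 \<le> f m n x"
    and "\<And>x. x \<in> A \<Longrightarrow> 1 \<le> (\<Sum>m n. ennreal (f m n x))"
  shows "cover_measure A \<le> (\<Sum>m n. ennreal (L (f m n)))"
proof -
  let ?F = "\<lambda>i. case_prod f (prod_decode i)"
  have "(\<Sum>i. ennreal (?F i x)) = (\<Sum>m n. ennreal (f m n x))" for x
    using suminf_ennreal_2dimen[of "\<lambda>m. \<Sum>n. ennreal (f m n x)" "\<lambda>(m, n). ennreal (f m n x)"]
    by (simp add: case_prod_beta)
  then have "?F \<in> covers A"
    using assms by (auto simp: covers_def case_prod_beta)
  then have "cover_measure A \<le> (\<Sum>i. ennreal (L (?F i)))"
    unfolding cover_measure_def by (rule INF_lower)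
  also have "\<dots> = (\<Sum>m n. ennreal (L (f m n)))"
    using suminf_ennreal_2dimen[of "\<lambda>m. \<Sum>n. ennreal (L (f m n))" "\<lambda>(m, n). ennreal (L (f m n))"]
    by (simp add: case_prod_beta)
  finally show ?thesis .
qed

lemma cover_measure_UN: "cover_measure (\<Union>i. A i) \<le> (\<Sum>i::nat. cover_measure (A i))"
proof (rule ennreal_le_epsilon)
  fix e :: real assume e: "0 < e"
  \<comment> \<open>The covers come within \<open>e * (1/2) ^ Suc n\<close> of the infimum, and
    these errors add up to \<open>e\<close>. The strict inequality behind the choice needs a finite
    value, which the constant cover 1 provides.\<close>
  have "\<exists>f\<in>covers (A n). (\<Sum>i. ennreal (L (f i))) \<le> cover_measure (A n) + e * (1/2) ^ Suc n" for n
  proof -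
    have "cover_measure (A n) \<le> cover_measure UNIV"
      by (rule cover_measure_mono) simp
    also have "\<dots> \<le> ennreal (L (\<lambda>x. 1))"
      by (rule cover_measure_le) auto
    finally have "cover_measure (A n) \<noteq> \<infinity>"
      by (auto simp: top_unique)
    then have "cover_measure (A n) < cover_measure (A n) + ennreal (e * (1/2) ^ Suc n)"
      using e by (auto simp: ennreal_add_left_cancel_less less_top[symmetric])
    then show ?thesis
      unfolding cover_measure_def INF_less_iff by (auto intro: less_imp_le)
  qed
  then obtain f where f: "\<And>n. f n \<in> covers (A n)"
    and le: "\<And>n. (\<Sum>i. ennreal (L (f n i))) \<le> cover_measure (A n) + e * (1/2) ^ Suc n"
    by metis
  have "cover_measure (\<Union>i. A i) \<le> (\<Sum>m n. ennreal (L (f m n)))"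
  proof (rule cover_measure_double)
    fix x assume "x \<in> (\<Union>i. A i)"
    then obtain m where "x \<in> A m" by auto
    then have "1 \<le> (\<Sum>n. ennreal (f m n x))" using f[of m] by (auto simp: covers_def)
    also have "\<dots> \<le> (\<Sum>m n. ennreal (f m n x))"
      using sum_le_suminf[of "\<lambda>m. \<Sum>n. ennreal (f m n x)" "{m}"] by simp
    finally show "1 \<le> (\<Sum>m n. ennreal (f m n x))" .
  qed (use f in \<open>auto simp: covers_def\<close>)
  also have "\<dots> \<le> (\<Sum>n. cover_measure (A n) + ennreal (e * (1/2) ^ Suc n))"
    by (intro suminf_le le) auto
  also have "\<dots> = (\<Sum>n. cover_measure (A n)) + (\<Sum>n. ennreal e * ennreal ((1/2) ^ Suc n))"
    using e by (subst suminf_add[symmetric])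
      (auto simp del: ennreal_suminf_cmult simp add: ennreal_mult[symmetric])
  also have "\<dots> = (\<Sum>n. cover_measure (A n)) + e"
    unfolding ennreal_suminf_cmult
    by (subst suminf_ennreal_eq[OF zero_le_power power_half_series]) auto
  finally show "cover_measure (\<Union>i. A i) \<le> (\<Sum>n. cover_measure (A n)) + e" .
qed

lemma outer_measure_space_cover_measure: "outer_measure_space (Pow X) cover_measure"
  unfolding outer_measure_space_def positive_def increasing_def countably_subadditive_def
  by (auto simp: cover_measure_empty intro: cover_measure_mono cover_measure_UN)

text \<open>
  A cover \<open>f\<close> of \<open>E\<close> is cut with \<open>g\<^sub>n = min 1 (n h)\<close>, which increases to the indicator of \<open>{h > 0}\<close>:
  the products \<open>f\<^sub>i (g\<^sub>n\<^sub>+\<^sub>1 - g\<^sub>n)\<close> cover the part of \<open>E\<close> inside, and for each \<open>N\<close> the products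
  \<open>f\<^sub>i (1 - g\<^sub>N)\<close> cover the part outside.
\<close>

lemma cover_measure_split:
  fixes h :: "'a \<Rightarrow> real"
  assumes h: "continuous_on X h" and E: "E \<subseteq> X"
  shows "cover_measure (E \<inter> {x\<in>X. 0 < h x}) + cover_measure (E - {x\<in>X. 0 < h x}) \<le> cover_measure E"
    (is "cover_measure (E \<inter> ?U) + _ \<le> _")
proof -
  have "cover_measure (E \<inter> ?U) + cover_measure (E - ?U) \<le> (\<Sum>i. ennreal (L (f i)))"
    if "f \<in> covers E" for f
  proof -
    have f: "continuous_on X (f i)" "\<And>x. x \<in> X \<Longrightarrow> 0 \<le> f i x" "\<And>x. x \<in> E \<Longrightarrow> 1 \<le> (\<Sum>i. ennreal (f i x))" for i
      using that by (auto simp: covers_def)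
    \<comment> \<open>Since \<open>h\<close> may be negative, \<open>max 0\<close> is needed to make
      \<open>g n x\<close> nondecreasing in \<open>n\<close> and zero wherever
      \<open>h x <= 0\<close>.\<close>
    define g :: "nat \<Rightarrow> 'a \<Rightarrow> real" where "g n x = min 1 (real n * max 0 (h x))" for n x
    define d where "d n x = g (Suc n) x - g n x" for n x
    have g: "continuous_on X (g n)" "0 \<le> g n x" "g n x \<le> 1" for n x
      unfolding g_def by (auto intro!: continuous_intros h)
    have d: "continuous_on X (d n)" "0 \<le> d n x" for n x
    proof -
      show "continuous_on X (d n)"
        unfolding d_def by (intro continuous_on_diff g)
      show "0 \<le> d n x"
        unfolding d_def g_def diff_ge_0_iff_ge by (intro min.mono mult_right_mono) auto
    qed
    have dsum: "(\<Sum>n<N. d n x) = g N x" for N x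
      unfolding d_def by (subst sum_lessThan_telescope) (simp add: g_def)
    have A: "cover_measure (E \<inter> ?U) \<le> (\<Sum>n i. ennreal (L (\<lambda>x. f i x * d n x)))"
    proof (rule cover_measure_double)
      fix x assume x: "x \<in> E \<inter> ?U"
      \<comment> \<open>Where \<open>h\<close> is positive the increments \<open>d n x\<close> add
        up to at least 1 by telescoping, and so does the cover \<open>f\<close>; hence so does the
        double sum of products.\<close>
      then obtain N where N: "1 < real N * h x"
        using reals_Archimedean3 by auto
      with x have "g N x = 1" by (simp add: g_def)
      then have "1 = (\<Sum>n<N. ennreal (d n x))"
        by (subst sum_ennreal) (auto simp: dsum d)
      also have "\<dots> \<le> (\<Sum>n. ennreal (d n x))"
        by (rule sum_le_suminf) auto
      also have "\<dots> \<le> (\<Sum>n. ennreal (d n x)) * (\<Sum>i. ennreal (f i x))"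
        using mult_left_mono[OF f(3)[of x], of "\<Sum>n. ennreal (d n x)"] x by simp
      also have "\<dots> = (\<Sum>n i. ennreal (d n x) * ennreal (f i x))"
        by simp
      also have "\<dots> = (\<Sum>n i. ennreal (f i x * d n x))"
      proof (intro arg_cong[where f = suminf] ext)
        fix n i
        have "0 \<le> f i x" using x E by (auto intro: f(2))
        then show "ennreal (d n x) * ennreal (f i x) = ennreal (f i x * d n x)"
          by (simp add: ennreal_mult d(2) mult.commute)
      qed
      finally show "1 \<le> (\<Sum>n i. ennreal (f i x * d n x))" .
    qed (auto intro!: continuous_intros f(1,2) d mult_nonneg_nonneg)
    have "(\<Sum>n. \<Sum>i. ennreal (L (\<lambda>x. f i x * d n x))) + cover_measure (E - ?U) \<le> (\<Sum>i. ennreal (L (f i)))"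
    \<comment> \<open>It suffices to bound every partial sum over \<open>n\<close>, so a different
      cover of the outside part may be used for each \<open>N\<close>.\<close>
    proof (rule ennreal_suminf_bound_add)
      fix N
      have "(\<Sum>n<N. \<Sum>i. ennreal (L (\<lambda>x. f i x * d n x))) = (\<Sum>i. \<Sum>n<N. ennreal (L (\<lambda>x. f i x * d n x)))"
        by (rule suminf_sum[symmetric]) auto
      also have "\<dots> = (\<Sum>i. ennreal (L (\<lambda>x. f i x * g N x)))"
      proof (intro arg_cong[where f = suminf] ext)
        fix i
        have "L (\<lambda>x. f i x * g N x) = L (\<lambda>x. \<Sum>n<N. f i x * d n x)"
          by (simp add: dsum sum_distrib_left[symmetric])
        also have "\<dots> = (\<Sum>n<N. L (\<lambda>x. f i x * d n x))"
          by (rule L_sum) (auto intro!: continuous_on_mult f(1) d(1))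
        finally show "(\<Sum>n<N. ennreal (L (\<lambda>x. f i x * d n x))) = ennreal (L (\<lambda>x. f i x * g N x))"
          by (simp add: L_nonneg continuous_on_mult f(1,2) d)
      qed
      finally have 1: "(\<Sum>n<N. \<Sum>i. ennreal (L (\<lambda>x. f i x * d n x))) = (\<Sum>i. ennreal (L (\<lambda>x. f i x * g N x)))" .
      have "(\<lambda>i x. f i x * (1 - g N x)) \<in> covers (E - ?U)"
      proof -
        have "g N x = 0" if "x \<in> E - ?U" for x
          using that E by (auto simp: g_def)
        then show ?thesis
          using g f by (auto simp: covers_def intro!: continuous_intros)
      qed
      then have "cover_measure (E - ?U) \<le> (\<Sum>i. ennreal (L (\<lambda>x. f i x * (1 - g N x))))"
        unfolding cover_measure_def by (rule INF_lower)
      then have "(\<Sum>n<N. \<Sum>i. ennreal (L (\<lambda>x. f i x * d n x))) + cover_measure (E - ?U) \<le>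
          (\<Sum>i. ennreal (L (\<lambda>x. f i x * g N x))) + (\<Sum>i. ennreal (L (\<lambda>x. f i x * (1 - g N x))))"
        unfolding 1 by (rule add_left_mono)
      also have "\<dots> = (\<Sum>i. ennreal (L (\<lambda>x. f i x * g N x)) + ennreal (L (\<lambda>x. f i x * (1 - g N x))))"
        by (rule suminf_add) auto
      also have "\<dots> = (\<Sum>i. ennreal (L (f i)))"
      proof (intro arg_cong[where f = suminf] ext)
        fix i
        have "L (\<lambda>x. f i x * g N x) + L (\<lambda>x. f i x * (1 - g N x)) = L (f i)"
          by (subst L_add[symmetric]) (auto intro!: continuous_intros f(1) g simp: right_diff_distrib)
        moreover have "0 \<le> L (\<lambda>x. f i x * g N x)" "0 \<le> L (\<lambda>x. f i x * (1 - g N x))"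
          by (auto intro!: L_nonneg continuous_intros f(1,2) g mult_nonneg_nonneg)
        ultimately show "ennreal (L (\<lambda>x. f i x * g N x)) + ennreal (L (\<lambda>x. f i x * (1 - g N x))) = ennreal (L (f i))"
          by (metis ennreal_plus)
      qed
      finally show "(\<Sum>n<N. \<Sum>i. ennreal (L (\<lambda>x. f i x * d n x))) + cover_measure (E - ?U)
        \<le> (\<Sum>i. ennreal (L (f i)))" .
    qed
    with A show ?thesis
      by (meson add_right_mono order_trans)
  qed
  then show ?thesis
    unfolding cover_measure_def[of E] by (rule INF_greatest)
qed

text \<open>The lower bound is where compactness enters. \<open>L\<close> is only finitely additive,
  so Dini's argument passes from a countable cover to one partial sum that is at least
  \<open>1 - e\<close> on all of \<open>X\<close>.\<close>

lemma cover_measure_X: "cover_measure X = 1"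
proof (rule antisym)
  show "cover_measure X \<le> 1"
    using cover_measure_le[of "\<lambda>x. 1" X] by (simp add: L_one)
  have "1 \<le> (\<Sum>i. ennreal (L (f i)))" if "f \<in> covers X" for f
  proof (rule ennreal_le_epsilon)
    fix e :: real assume e: "0 < e"
    have f: "continuous_on X (f i)" "\<And>x. x \<in> X \<Longrightarrow> 0 \<le> f i x" "\<And>x. x \<in> X \<Longrightarrow> 1 \<le> (\<Sum>i. ennreal (f i x))" for i
      using that by (auto simp: covers_def)
    define F where "F n x = (\<Sum>i<n. f i x)" for n x
    have F: "continuous_on X (F n)" for n
      unfolding F_def by (intro continuous_intros f(1))
    \<comment> \<open>If no \<open>K n\<close> were empty, these decreasing compact sets would have
      a common point, at which the whole cover would sum to at most \<open>1 - e\<close>.\<close>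
    define K where "K n = {x\<in>X. F n x \<le> 1 - e}" for n
    have "\<exists>n. K n = {}"
    proof (rule ccontr)
      assume ne: "\<nexists>n. K n = {}"
      have compact: "compact (K n)" for n
      proof -
        have "closedin (top_of_set X) (K n)"
          using continuous_closedin_preimage[OF F, of "{..1 - e}" n]
          by (auto simp: K_def vimage_def Int_def)
        then show ?thesis using compact_X closedin_compact by blast
      qed
      have K_mono: "K n \<subseteq> K m" if "m \<le> n" for m n
      proof -
        have "F m x \<le> F n x" if "x \<in> X" for x
          unfolding F_def using \<open>m \<le> n\<close> that by (intro sum_mono2 f(2)) auto
        then show ?thesis unfolding K_def using order_trans by blast
      qed
      have "X \<inter> (\<Inter>n\<in>UNIV. K n) \<noteq> {}"
      proof (rule compact_imp_fip_image[OF compact_X])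
        fix I :: "nat set" assume "finite I"
        \<comment> \<open>\<open>insert 0\<close> keeps \<open>Max\<close> meaningful when
          \<open>I\<close> is empty.\<close>
        then have "K (Max (insert 0 I)) \<subseteq> (\<Inter>n\<in>I. K n)"
          by (intro INT_greatest K_mono) simp
        moreover have "K (Max (insert 0 I)) \<subseteq> X"
          unfolding K_def by blast
        ultimately show "X \<inter> (\<Inter>n\<in>I. K n) \<noteq> {}"
          using ne by blast
      qed (rule compact_imp_closed[OF compact])
      then obtain x where x: "x \<in> X" "\<And>n. x \<in> K n" by blast
      then have "(\<Sum>i<n. f i x) \<le> 1 - e" for n by (auto simp: K_def F_def)
      then have "(\<Sum>i. ennreal (f i x)) \<le> ennreal (1 - e)"
        using x(1) by (intro suminf_le_const) (auto simp: sum_ennreal f(2) intro!: ennreal_leI)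
      also have "\<dots> < 1" using e by (auto simp: ennreal_less_one_iff)
      finally show False using f(3)[OF x(1)] by simp
    qed
    then obtain n where n: "\<And>x. x \<in> X \<Longrightarrow> 1 - e \<le> F n x"
      by (auto simp: K_def) (meson linear)
    have Lf: "0 \<le> L (f i)" for i
      by (intro L_nonneg f(1,2))
    have "L (\<lambda>x. 1 - e) \<le> L (F n)"
      by (rule L_mono[OF continuous_on_const F n])
    then have "1 - e \<le> L (F n)"
      by (simp add: L_const)
    also have "\<dots> = (\<Sum>i<n. L (f i))"
      unfolding F_def by (rule L_sum) (simp_all add: f(1))
    finally have "ennreal 1 \<le> ennreal ((\<Sum>i<n. L (f i)) + e)"
      by (intro ennreal_leI) simp
    also have "\<dots> = (\<Sum>i<n. ennreal (L (f i))) + ennreal e"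
      using e Lf by (simp add: sum_nonneg)
    also have "\<dots> \<le> (\<Sum>i. ennreal (L (f i))) + ennreal e"
      by (intro add_right_mono sum_le_suminf) auto
    finally show "1 \<le> (\<Sum>i. ennreal (L (f i))) + ennreal e" by simp
  qed
  then show "1 \<le> cover_measure X"
    unfolding cover_measure_def by (rule INF_greatest)
qed

end

section \<open>Borel sets and the representing measure\<close>

lemma continuous_positivity_set:
  fixes U :: "'a::metric_space set"
  assumes "open U"
  obtains h :: "'a \<Rightarrow> real" where "continuous_on UNIV h" "\<And>x. 0 \<le> h x" "U = {x. 0 < h x}"
\<comment> \<open>The witness is the distance to the complement. For \<open>U = UNIV\<close> the
  complement is empty and \<open>infdist\<close> is 0 by convention, so a positive constant is taken
  instead.\<close>
proof (cases "U = UNIV")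
  case True
  then show ?thesis by (intro that[of "\<lambda>x. 1"]) auto
next
  case False
  have "U = {x. 0 < infdist x (- U)}"
  proof (intro set_eqI iffI; unfold mem_Collect_eq)
    fix x
    show "0 < infdist x (- U)" if "x \<in> U"
      using that False assms by (intro infdist_pos_not_in_closed) auto
    show "x \<in> U" if "0 < infdist x (- U)"
      using that by (metis ComplI infdist_zero less_irrefl)
  qed
  then show ?thesis
    by (intro that[of "\<lambda>x. infdist x (- U)"])
      (auto intro!: continuous_intros infdist_nonneg)
qed

lemma sets_restrict_borel:
  "sets (restrict_space borel X) = sigma_sets X ((\<inter>) X ` {U. open U})"
proof -
  have "(\<inter>) X ` \<U> = {(\<lambda>x. x) -` U \<inter> X |U. U \<in> \<U>}" for \<U>
    by auto
  then show ?thesis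
    using sigma_sets_vimage_commute[of "\<lambda>x. x" X UNIV "{U. open U}"]
    by (simp only: sets_restrict_space sets_borel) simp
qed

lemma integrable_continuous_on_compact:
  fixes f :: "'a::metric_space \<Rightarrow> real"
  assumes "prob_space M" and M: "sets M = sets (restrict_space borel X)" and "compact X" and f: "continuous_on X f"
  shows "integrable M f"
proof -
  interpret prob_space M by fact
  have X: "space M = X"
    using sets_eq_imp_space_eq[OF M] by (simp add: space_restrict_space)
  have "f \<in> borel_measurable M"
    using borel_measurable_continuous_on_restrict[OF f] by (simp add: measurable_cong_sets[OF M refl])
  moreover obtain B where "\<And>x. x \<in> X \<Longrightarrow> norm (f x) \<le> B"
    using compact_imp_bounded[OF compact_continuous_image[OF f \<open>compact X\<close>]] by (auto simp: bounded_iff)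
  ultimately show ?thesis
    by (intro integrable_const_bound[of _ B]) (auto simp: X)
qed

context positive_functional
begin

text \<open>Caratheodory's lemma makes \<open>cover_measure\<close> a measure on the lambda system.
  By \<open>cover_measure_split\<close> and subadditivity, traces of open sets belong to it, and
  hence all Borel sets of \<open>X\<close>.\<close>

lemma cover_probability_exists:
  obtains \<mu> where "sets \<mu> = sets (restrict_space borel X)" "prob_space \<mu>"
    "\<And>A. A \<in> sets \<mu> \<Longrightarrow> emeasure \<mu> A = cover_measure A"
proof -
  interpret P: sigma_algebra X "Pow X" by (rule sigma_algebra_Pow)
  define S where "S = lambda_system X (Pow X) cover_measure"
  have ms: "measure_space X S cover_measure"
    unfolding S_def by (rule P.caratheodory_lemma[OF outer_measure_space_cover_measure])
  then interpret S: sigma_algebra X S by (simp add: measure_space_def)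
  have "X \<inter> U \<in> S" if "open U" for U
  proof -
    obtain h :: "'a \<Rightarrow> real" where h: "continuous_on UNIV h" "U = {x. 0 < h x}"
      using continuous_positivity_set[OF \<open>open U\<close>] by metis
    have U: "X \<inter> U = {x\<in>X. 0 < h x}" using h by auto
    have "cover_measure E = cover_measure (E \<inter> (X \<inter> U)) + cover_measure (E - (X \<inter> U))" if "E \<subseteq> X" for E
    proof (rule antisym)
      have "subadditive (Pow X) cover_measure"
        using outer_measure_space_cover_measure
        by (auto simp: outer_measure_space_def intro: P.countably_subadditive_subadditive)
      then have "cover_measure (E \<inter> (X \<inter> U) \<union> (E - (X \<inter> U))) \<le>
          cover_measure (E \<inter> (X \<inter> U)) + cover_measure (E - (X \<inter> U))"
        by (rule subadditiveD) (use that in auto)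
      then show "cover_measure E \<le> cover_measure (E \<inter> (X \<inter> U)) + cover_measure (E - (X \<inter> U))"
        by (simp add: Int_Diff_Un)
      show "cover_measure (E \<inter> (X \<inter> U)) + cover_measure (E - (X \<inter> U)) \<le> cover_measure E"
        unfolding U using that h(1) by (intro cover_measure_split) (auto intro: continuous_on_subset)
    qed
    then show ?thesis
      unfolding S_def P.lambda_system_eq by auto
  qed
  then have sub: "sets (restrict_space borel X) \<subseteq> S"
    unfolding sets_restrict_borel by (intro S.sigma_sets_subset) auto
  \<comment> \<open>The lambda system may be larger than the Borel sets, so the measure is
    restricted to the latter.\<close>
  define \<mu> where "\<mu> = measure_of X (sets (restrict_space borel X)) cover_measure"
  have sa: "sigma_algebra X (sets (restrict_space borel X))"
    using sets.sigma_algebra_axioms[of "restrict_space borel X"] by (simp add: space_restrict_space)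
  then have sets: "sets \<mu> = sets (restrict_space borel X)" and space: "space \<mu> = X"
    unfolding \<mu>_def by (auto simp: sigma_algebra.sets_measure_of_eq sigma_algebra.space_measure_of_eq)
  have em: "emeasure \<mu> A = cover_measure A" if "A \<in> sets \<mu>" for A
  proof (rule emeasure_measure_of[OF \<mu>_def])
    show "sets (restrict_space borel X) \<subseteq> Pow X"
      using sets.space_closed[of "restrict_space borel X"] by (simp add: space_restrict_space)
    show "positive (sets \<mu>) cover_measure"
      by (simp add: positive_def cover_measure_empty)
    show "countably_additive (sets \<mu>) cover_measure"
      using ms sub by (auto simp: measure_space_def countably_additive_def sets)
  qed (fact that)
  moreover have "prob_space \<mu>"
    using em[OF sets.top] by (intro prob_spaceI) (simp add: space cover_measure_X)
  ultimately show ?thesis using that sets by blast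
qed

text \<open>Only the inequality of the integral against \<open>L\<close> from above has to be
  proved; applying it to \<open>- f\<close> gives the converse. Covers bound measures of sets from
  above by values of \<open>L\<close>, which is exactly this direction.\<close>

theorem riesz_representation:
  obtains \<mu> where "sets \<mu> = sets (restrict_space borel X)" "prob_space \<mu>"
    "\<And>f. continuous_on X f \<Longrightarrow> integral\<^sup>L \<mu> f = L f"
proof -
  obtain \<mu> where sets: "sets \<mu> = sets (restrict_space borel X)" and "prob_space \<mu>"
    and em: "\<And>A. A \<in> sets \<mu> \<Longrightarrow> emeasure \<mu> A = cover_measure A"
    using cover_probability_exists by blast
  interpret prob_space \<mu> by fact
  note int = integrable_continuous_on_compact[OF \<open>prob_space \<mu>\<close> sets compact_X]
  have X: "space \<mu> = X"
    using sets_eq_imp_space_eq[OF sets] by (simp add: space_restrict_space)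
  have bounded: "\<exists>B. \<forall>x\<in>X. \<bar>f x\<bar> \<le> B" if "continuous_on X f" for f :: "'a \<Rightarrow> real"
    using compact_imp_bounded[OF compact_continuous_image[OF that compact_X]] by (auto simp: bounded_iff)
  \<comment> \<open>Layer cake with unit steps; the error 1 disappears when \<open>h\<close> is replaced by \<open>n h\<close>.\<close>
  have layers: "integral\<^sup>L \<mu> h \<le> 1 + L h"
    if h: "continuous_on X h" "\<And>x. x \<in> X \<Longrightarrow> 0 \<le> h x" for h
  proof -
    obtain B where B: "\<forall>x\<in>X. \<bar>h x\<bar> \<le> B" using bounded[OF h(1)] by blast
    obtain K :: nat where "B \<le> real K" using real_arch_simple by blast
    with B have K: "h x \<le> real K" if "x \<in> X" for x using that by force
    define l where "l k x = min (h x) (real (Suc k)) - min (h x) (real k)" for k :: nat and x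
    have l: "continuous_on X (l k)" for k
      unfolding l_def by (intro continuous_intros h)
    have lsum: "(\<Sum>k<N. l k x) = h x" if "x \<in> X" "K \<le> N" for N x
    proof -
      have "h x \<le> real N" using K[OF that(1)] that(2) by linarith
      then show ?thesis
        unfolding l_def using h(2)[OF that(1)] by (subst sum_lessThan_telescope) simp
    qed
    \<comment> \<open>\<open>A\<close> lies between two consecutive layers: \<open>l (Suc k)\<close>
      is at most 1 and vanishes off \<open>A\<close>, while \<open>l k\<close> equals 1 on
      \<open>A\<close> and so covers it. The index shift leaves \<open>l 0\<close> over, which costs
      the error 1.\<close>
    have step: "integral\<^sup>L \<mu> (l (Suc k)) \<le> L (l k)" for k
    proof -
      define A where "A = {x\<in>X. real (Suc k) \<le> h x}"
      have A: "A \<in> sets \<mu>"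
        using measurable_sets[OF borel_measurable_integrable[OF int[OF h(1)]], of "{real (Suc k)..}"]
        by (simp add: A_def X vimage_def Int_def conj_commute)
      have "integral\<^sup>L \<mu> (l (Suc k)) \<le> integral\<^sup>L \<mu> (indicator A)"
      proof (rule integral_mono[OF int[OF l]])
        show "integrable \<mu> (indicator A :: 'a \<Rightarrow> real)"
          using A by (simp add: integrable_indicator_iff less_top[symmetric])
        show "l (Suc k) x \<le> indicator A x" if "x \<in> space \<mu>" for x
          using that by (auto simp: l_def A_def X indicator_def)
      qed
      also have "\<dots> = measure \<mu> A" using A by simp
      also have "\<dots> \<le> L (l k)"
      proof -
        have nn: "0 \<le> l k x" for x by (auto simp: l_def)
        have "emeasure \<mu> A \<le> ennreal (L (l k))"
          unfolding em[OF A] using nn by (intro cover_measure_le l) (auto simp: l_def A_def)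
        then show ?thesis
          using L_nonneg[OF l nn] by (simp add: emeasure_eq_measure)
      qed
      finally show ?thesis .
    qed
    have "integral\<^sup>L \<mu> h = integral\<^sup>L \<mu> (\<lambda>x. \<Sum>k<Suc K. l k x)"
      by (rule Bochner_Integration.integral_cong) (auto simp: lsum X simp del: sum.lessThan_Suc)
    also have "\<dots> = (\<Sum>k<Suc K. integral\<^sup>L \<mu> (l k))"
      by (rule Bochner_Integration.integral_sum) (rule int[OF l])
    also have "\<dots> = integral\<^sup>L \<mu> (l 0) + (\<Sum>k<K. integral\<^sup>L \<mu> (l (Suc k)))"
      by (rule sum.lessThan_Suc_shift)
    also have "\<dots> \<le> 1 + (\<Sum>k<K. L (l k))"
    proof (rule add_mono)
      have "integral\<^sup>L \<mu> (l 0) \<le> integral\<^sup>L \<mu> (\<lambda>x. 1)"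
        using h(2) by (intro integral_mono int l) (auto simp: l_def X)
      then show "integral\<^sup>L \<mu> (l 0) \<le> 1" by (simp add: prob_space)
    qed (rule sum_mono[OF step])
    also have "(\<Sum>k<K. L (l k)) = L h"
      using l by (subst L_sum[symmetric]) (auto intro!: L_cong continuous_intros simp: lsum)
    finally show ?thesis .
  qed
  have nonneg: "integral\<^sup>L \<mu> h \<le> L h"
    if h: "continuous_on X h" "\<And>x. x \<in> X \<Longrightarrow> 0 \<le> h x" for h
  proof (rule ccontr)
    assume "\<not> integral\<^sup>L \<mu> h \<le> L h"
    then obtain n :: nat where n: "1 < real n * (integral\<^sup>L \<mu> h - L h)"
      using reals_Archimedean3 by (metis diff_gt_0_iff_gt not_le)
    have "integral\<^sup>L \<mu> (\<lambda>x. real n * h x) \<le> 1 + L (\<lambda>x. real n * h x)"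
      using h by (intro layers) (auto intro!: continuous_intros)
    with n h show False by (simp add: L_cmult algebra_simps)
  qed
  have le: "integral\<^sup>L \<mu> f \<le> L f" if f: "continuous_on X f" for f
  proof -
    \<comment> \<open>Adding the constant \<open>B\<close> makes \<open>f\<close> nonnegative on
      \<open>X\<close> and changes both sides by \<open>B\<close>.\<close>
    obtain B where B: "\<And>x. x \<in> X \<Longrightarrow> \<bar>f x\<bar> \<le> B" using bounded[OF f] by blast
    have "integral\<^sup>L \<mu> (\<lambda>x. f x + B) \<le> L (\<lambda>x. f x + B)"
      using B by (intro nonneg continuous_intros f) (force simp: abs_le_iff)
    then show ?thesis
      using int[OF f] by (simp add: L_add[OF f] L_const prob_space)
  qed
  have "integral\<^sup>L \<mu> f = L f" if f: "continuous_on X f" for f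
  proof (rule antisym)
    have "integral\<^sup>L \<mu> (\<lambda>x. - f x) \<le> L (\<lambda>x. - f x)"
      by (intro le continuous_intros f)
    then show "L f \<le> integral\<^sup>L \<mu> f"
      using L_cmult[OF f, of "-1"] by simp
  qed (rule le[OF f])
  with sets \<open>prob_space \<mu>\<close> show ?thesis by (rule that)
qed

end

section \<open>Uniqueness of the representing measure\<close>

text \<open>The functions \<open>min 1 (n * h)\<close> increase to the indicator of
  \<open>{h > 0}\<close>. By dominated convergence the measures agree on traces of open sets, which
  form an intersection-stable generator.\<close>

lemma prob_measure_eqI_continuous:
  fixes X :: "'a::metric_space set"
  assumes "compact X" and M: "sets M = sets (restrict_space borel X)" "prob_space M"
    and N: "sets N = sets (restrict_space borel X)" "prob_space N"
    and eq: "\<And>f::'a \<Rightarrow> real. continuous_on X f \<Longrightarrow> integral\<^sup>L M f = integral\<^sup>L N f"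
  shows "M = N"
proof -
  interpret M: prob_space M by fact
  interpret N: prob_space N by fact
  have *: "(\<lambda>n. integral\<^sup>L K (\<lambda>x. min 1 (real n * h x))) \<longlonglongrightarrow> measure K {x\<in>X. 0 < h x}"
    if K: "sets K = sets (restrict_space borel X)" "prob_space K"
      and h: "continuous_on X h" "\<And>x. 0 \<le> h x" for h :: "'a \<Rightarrow> real" and K
  proof -
    interpret K: prob_space K by fact
    have X: "space K = X"
      using sets_eq_imp_space_eq[OF K(1)] by (simp add: space_restrict_space)
    note int = integrable_continuous_on_compact[OF K(2,1) \<open>compact X\<close>]
    have "{x\<in>X. 0 < h x} \<in> sets K"
      using measurable_sets[OF borel_measurable_integrable[OF int[OF h(1)]], of "{0<..}"]
      by (simp add: X vimage_def Int_def conj_commute)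
    then have "measure K {x\<in>X. 0 < h x} = integral\<^sup>L K (indicator {x\<in>X. 0 < h x})"
      by simp
    moreover have "(\<lambda>n. integral\<^sup>L K (\<lambda>x. min 1 (real n * h x))) \<longlonglongrightarrow>
        integral\<^sup>L K (indicator {x\<in>X. 0 < h x})"
    proof (rule integral_dominated_convergence[where w = "\<lambda>x. 1"])
      show "(\<lambda>x. min 1 (real n * h x)) \<in> borel_measurable K" for n
        by (intro borel_measurable_integrable int continuous_intros h)
      show "AE x in K. (\<lambda>n. min 1 (real n * h x)) \<longlonglongrightarrow> indicator {x\<in>X. 0 < h x} x"
      proof (rule AE_I2)
        fix x assume x: "x \<in> space K"
        show "(\<lambda>n. min 1 (real n * h x)) \<longlonglongrightarrow> indicator {x\<in>X. 0 < h x} x"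
        proof (cases "0 < h x")
          case True
          then obtain n where "1 < real n * h x" using reals_Archimedean3 by auto
          then have "1 \<le> real m * h x" if "n \<le> m" for m
            using mult_right_mono[of "real n" "real m" "h x"] that True by linarith
          then have "\<forall>\<^sub>F m in sequentially. min 1 (real m * h x) = 1"
            unfolding eventually_sequentially by (metis min_absorb1)
          with True x X show ?thesis by (simp add: tendsto_eventually)
        next
          case False
          with h(2)[of x] show ?thesis by simp
        qed
      qed
      show "(indicator {x\<in>X. 0 < h x} :: 'a \<Rightarrow> real) \<in> borel_measurable K"
        by (rule borel_measurable_indicator) fact
      show "AE x in K. norm (min 1 (real n * h x)) \<le> 1" for n
        using h(2) by (intro AE_I2) simp
    qed simp
    ultimately show ?thesis by simp
  qed
  have "emeasure M A = emeasure N A" if "A \<in> (\<inter>) X ` {U. open U}" for A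
  proof -
    from that obtain U where U: "open U" "A = X \<inter> U" by auto
    obtain h :: "'a \<Rightarrow> real" where h: "continuous_on UNIV h" "\<And>x. 0 \<le> h x" "U = {x. 0 < h x}"
      using continuous_positivity_set[OF U(1)] by metis
    have hX: "continuous_on X h" using h(1) by (rule continuous_on_subset) simp
    have A: "A = {x\<in>X. 0 < h x}" using U h by auto
    have "integral\<^sup>L M (\<lambda>x. min 1 (real n * h x)) = integral\<^sup>L N (\<lambda>x. min 1 (real n * h x))" for n
      by (intro eq continuous_intros hX)
    then have "(\<lambda>n. integral\<^sup>L N (\<lambda>x. min 1 (real n * h x))) \<longlonglongrightarrow> measure M A"
      using *[OF M hX h(2)] by (simp only: A)
    then have "measure M A = measure N A"
      by (rule LIMSEQ_unique) (use *[OF N hX h(2)] in \<open>simp only: A\<close>)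
    then show ?thesis by (simp add: M.emeasure_eq_measure N.emeasure_eq_measure)
  qed
  moreover have "Int_stable ((\<inter>) X ` {U. open U})"
  proof (rule Int_stableI_image)
    fix U V :: "'a set" assume "U \<in> {U. open U}" "V \<in> {U. open U}"
    then show "\<exists>W\<in>{U. open U}. X \<inter> U \<inter> (X \<inter> V) = X \<inter> W"
      by (intro bexI[of _ "U \<inter> V"]) auto
  qed
  moreover have "X \<in> (\<inter>) X ` {U. open U}"
    by (rule image_eqI[of _ _ UNIV]) simp_all
  ultimately show ?thesis
    using M(1) N(1) unfolding sets_restrict_borel
    by (intro measure_eqI_generator_eq[where \<Omega> = X and E = "(\<inter>) X ` {U. open U}" and A = "\<lambda>_. X"])
      (simp_all add: image_subset_iff)
qed

section \<open>Cluster points of bounded families\<close>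

text \<open>
  Tychonoff's theorem gives a cluster point; passing to a finer filter instead of a subsequence avoids
  any separability argument.
\<close>

lemma pointwise_cluster_filter:
  fixes \<phi> :: "'i \<Rightarrow> 'b \<Rightarrow> real"
  assumes "F \<noteq> bot" and bound: "\<And>f i. \<bar>\<phi> i f\<bar> \<le> B f"
  obtains G L where "G \<noteq> bot" "G \<le> F" "\<And>f. ((\<lambda>i. \<phi> i f) \<longlongrightarrow> L f) G"
proof -
  have "compact (PiE UNIV (\<lambda>f. {- B f..B f}))"
    using compactin_PiE[of "\<lambda>_. euclidean" UNIV "\<lambda>f. {- B f..B f}"]
    by (simp add: euclidean_product_topology compactin_euclidean_iff)
  moreover have "eventually (\<lambda>g. g \<in> PiE UNIV (\<lambda>f. {- B f..B f})) (filtermap \<phi> F)"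
    unfolding eventually_filtermap
  proof (intro always_eventually allI PiE_I)
    show "\<phi> i f \<in> {- B f..B f}" for i f
      using bound[of i f] by (simp add: abs_le_iff)
  qed simp
  ultimately obtain L where L: "inf (nhds L) (filtermap \<phi> F) \<noteq> bot"
    using \<open>F \<noteq> bot\<close> unfolding compact_filter by (metis filtermap_bot_iff)
  \<comment> \<open>Compactness gives a cluster point of the image filter only; \<open>G\<close>
    pulls its neighbourhoods back to the index set, so that \<open>\<phi>\<close> converges along
    \<open>G\<close>.\<close>
  define G where "G = inf (filtercomap \<phi> (nhds L)) F"
  show ?thesis
  proof
    show "G \<noteq> bot"
    proof
      assume "G = bot"
      then obtain P Q where P: "eventually P (nhds L)" and Q: "eventually Q F" and no: "\<And>i. P (\<phi> i) \<Longrightarrow> Q i \<Longrightarrow> False"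
        unfolding G_def trivial_limit_def eventually_inf eventually_filtercomap by blast
      have "eventually (\<lambda>g. \<not> P g) (filtermap \<phi> F)"
        unfolding eventually_filtermap using Q by (rule eventually_mono) (use no in auto)
      with P have "eventually (\<lambda>g. False) (inf (nhds L) (filtermap \<phi> F))"
        unfolding eventually_inf by blast
      with L show False by (simp add: trivial_limit_def)
    qed
    show "G \<le> F" by (simp add: G_def)
    show "((\<lambda>i. \<phi> i f) \<longlongrightarrow> L f) G" for f
    proof -
      have "(\<phi> \<longlongrightarrow> L) G"
        unfolding G_def by (intro filterlim_mono[OF filterlim_filtercomap]) auto
      then show ?thesis
        by (rule continuous_on_tendsto_compose[OF continuous_on_product_coordinates[of f]]) auto
    qed
  qed
qed

subsection \<open>Logarithmic averages\<close>

lemma log_average_add: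
  "log_average T (\<lambda>y. f y + g y) n x = log_average T f n x + log_average T g n x"
  by (simp add: log_average_def sum.distrib ring_distribs)

lemma log_average_cmult: "log_average T (\<lambda>y. c * f y) n x = c * log_average T f n x"
  by (simp add: log_average_def sum_distrib_left mult_ac)

text \<open>Positivity of \<open>n\<close> matters: for \<open>n = 0\<close> the average is 0
  whatever \<open>c\<close> is.\<close>

lemma log_average_const: "0 < n \<Longrightarrow> log_average T (\<lambda>y. c) n x = c"
  unfolding log_average_def sum_distrib_right[symmetric]
  using harm_pos[of n, where ?'a = real] by (simp add: harm_def inverse_eq_divide)

lemma log_window_average_eq:
  assumes "m \<le> n"
  shows "log_window_average T f m n x = log_average T f (n - m) ((T ^^ m) x)"
proof -
  have "(\<Sum>k=m+1..n. 1 / real (k - m) * f ((T ^^ (k - 1)) x)) =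
      (\<Sum>k=1+m..(n-m)+m. 1 / real (k - m) * f ((T ^^ (k - 1)) x))"
    using assms by (simp add: add.commute)
  also have "\<dots> = (\<Sum>k=1..n-m. 1 / real k * f ((T ^^ (k - 1)) ((T ^^ m) x)))"
    unfolding sum.shift_bounds_cl_nat_ivl
  proof (rule sum.cong)
    fix k assume "k \<in> {1..n-m}"
    then have "k + m - 1 = (k - 1) + m" by simp
    then show "1 / real (k + m - m) * f ((T ^^ (k + m - 1)) x) = 1 / real k * f ((T ^^ (k - 1)) ((T ^^ m) x))"
      by (simp add: funpow_add)
  qed simp
  finally show ?thesis
    by (simp add: log_window_average_def log_average_def)
qed

context topological_dynamical_system
begin

lemma funpow_in: "x \<in> X \<Longrightarrow> (T ^^ k) x \<in> X"
  using maps_into by (induction k) auto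

lemma continuous_on_funpow: "continuous_on X (T ^^ k)"
proof (induction k)
  case (Suc k)
  then show ?case
    using continuous_on_compose[OF Suc continuous_on_subset[OF continuous]] funpow_in by auto
qed (simp add: id_def)

lemma continuous_on_compose_funpow:
  fixes f :: "'a \<Rightarrow> real"
  assumes "continuous_on X f"
  shows "continuous_on X (\<lambda>x. f ((T ^^ k) x))"
  using continuous_on_compose2[OF assms continuous_on_funpow] funpow_in by blast

lemma log_average_mono:
  assumes "\<And>y. y \<in> X \<Longrightarrow> f y \<le> g y" "x \<in> X"
  shows "log_average T f n x \<le> log_average T g n x"
  unfolding log_average_def
  by (intro mult_left_mono sum_mono) (auto simp: harm_nonneg assms funpow_in)

lemma abs_log_average_le:
  assumes "\<And>y. y \<in> X \<Longrightarrow> \<bar>f y\<bar> \<le> B" "x \<in> X"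
  shows "\<bar>log_average T f n x\<bar> \<le> B"
proof (cases "n = 0")
  case True
  \<comment> \<open>The empty average is 0, and the bound at the point \<open>x\<close> shows that
    \<open>B\<close> is nonnegative.\<close>
  have "0 \<le> B" using assms by force
  with True show ?thesis by (simp add: log_average_def)
next
  case False
  have "log_average T f n x \<le> log_average T (\<lambda>y. B) n x"
    using assms by (intro log_average_mono) (auto simp: abs_le_iff)
  moreover have "log_average T (\<lambda>y. - B) n x \<le> log_average T f n x"
    using assms by (intro log_average_mono) (force simp: abs_le_iff)+
  ultimately show ?thesis
    using False by (simp add: log_average_const abs_le_iff)
qed

text \<open>The weights \<open>1 / k\<close> have bounded variation, so before normalisation the
  difference stays within \<open>2 * B\<close> for all \<open>n\<close>; the divergence of
  \<open>harm n\<close> then makes it negligible.\<close>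

lemma log_average_shift_diff_le:
  assumes B: "\<And>y. y \<in> X \<Longrightarrow> \<bar>f y\<bar> \<le> B" and x: "x \<in> X"
  shows "\<bar>log_average T (\<lambda>y. f (T y)) n x - log_average T f n x\<bar> \<le> 2 * B / harm n"
proof -
  define a where "a k = f ((T ^^ k) x)" for k
  have a: "\<bar>a k\<bar> \<le> B" for k
    unfolding a_def by (intro B funpow_in x)
  define S where "S n = (\<Sum>k=1..n. (a k - a (k - 1)) / real k)" for n
  \<comment> \<open>Summation by parts; the boundary term is subtracted so that the bound closes under induction.\<close>
  have S: "\<bar>S n - a n / (real n + 1)\<bar> \<le> B * (2 - 1 / (real n + 1))" for n
  proof (induction n)
    case 0
    show ?case using a[of 0] by (simp add: S_def)
  next
    case (Suc n)
    \<comment> \<open>\<open>t\<close> is the drop between consecutive weights, the coefficient left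
      on \<open>a (Suc n)\<close> when the boundary term moves from \<open>n\<close> to
      \<open>Suc n\<close>.\<close>
    define t where "t = 1 / (real n + 1) - 1 / (real n + 2)"
    have t: "0 \<le> t" by (simp add: t_def frac_le)
    have "S (Suc n) = S n + (a (Suc n) - a n) / (real n + 1)"
      by (simp add: S_def add.commute)
    then have "S (Suc n) - a (Suc n) / (real (Suc n) + 1) = (S n - a n / (real n + 1)) + a (Suc n) * t"
      by (simp add: t_def diff_divide_distrib right_diff_distrib)
    also have "\<bar>\<dots>\<bar> \<le> B * (2 - 1 / (real n + 1)) + B * t"
    proof (rule order_trans[OF abs_triangle_ineq add_mono[OF Suc]])
      show "\<bar>a (Suc n) * t\<bar> \<le> B * t"
        using mult_right_mono[OF a[of "Suc n"] t] t by (simp add: abs_mult)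
    qed
    also have "\<dots> = B * (2 - 1 / (real (Suc n) + 1))"
      by (simp add: t_def right_diff_distrib)
    finally show ?case .
  qed
  \<comment> \<open>Adding the boundary term back costs \<open>B / (n + 1)\<close>, exactly the
    slack kept in the inductive bound.\<close>
  have "\<bar>a n / (real n + 1)\<bar> \<le> B / (real n + 1)"
    using a[of n] by (simp add: abs_divide divide_right_mono)
  moreover have "\<bar>S n\<bar> \<le> \<bar>S n - a n / (real n + 1)\<bar> + \<bar>a n / (real n + 1)\<bar>"
    by linarith
  ultimately have "\<bar>S n\<bar> \<le> 2 * B"
    using S[of n] by (simp add: right_diff_distrib)
  moreover have "log_average T (\<lambda>y. f (T y)) n x - log_average T f n x = S n / harm n"
  proof -
    have "log_average T (\<lambda>y. f (T y)) n x - log_average T f n x =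
        1 / harm n * (\<Sum>k=1..n. 1 / real k * f (T ((T ^^ (k - 1)) x)) - 1 / real k * f ((T ^^ (k - 1)) x))"
      by (simp add: log_average_def sum_subtractf right_diff_distrib)
    also have "(\<Sum>k=1..n. 1 / real k * f (T ((T ^^ (k - 1)) x)) - 1 / real k * f ((T ^^ (k - 1)) x)) = S n"
      unfolding S_def a_def
    proof (rule sum.cong)
      fix k assume "k \<in> {1..n}"
      then have "T ((T ^^ (k - 1)) x) = (T ^^ k) x" by (cases k) auto
      then show "1 / real k * f (T ((T ^^ (k - 1)) x)) - 1 / real k * f ((T ^^ (k - 1)) x) =
          (f ((T ^^ k) x) - f ((T ^^ (k - 1)) x)) / real k"
        by (simp add: diff_divide_distrib)
    qed simp
    finally show ?thesis by simp
  qed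
  ultimately show ?thesis
    by (simp add: harm_nonneg divide_right_mono)
qed

lemma bounded_continuous:
  fixes f :: "'a \<Rightarrow> real"
  assumes "continuous_on X f"
  obtains B where "\<And>x. x \<in> X \<Longrightarrow> \<bar>f x\<bar> \<le> B"
  using compact_imp_bounded[OF compact_continuous_image[OF assms compact]] by (auto simp: bounded_iff)

lemma measurable_T:
  assumes "sets M = sets (restrict_space borel X)"
  shows "T \<in> measurable M (restrict_space borel X)"
  using maps_into borel_measurable_continuous_on_restrict[OF continuous]
  by (intro measurable_restrict_space2)
    (auto simp: measurable_cong_sets[OF assms refl] sets_eq_imp_space_eq[OF assms] space_restrict_space)

section \<open>Invariant measures as limits of averages\<close>

text \<open>One filter \<open>G\<close> serves all \<open>f\<close>, and base points may vary with
  the index: a fixed point yields existence of an invariant measure, varying points exploit a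
  failure of uniform convergence.\<close>

theorem krylov_bogoliubov:
  assumes "F \<noteq> bot" and N: "filterlim N at_top F" and x: "\<And>i. x i \<in> X"
  obtains \<mu> G where "\<mu> \<in> invariant_prob_measures X T" "G \<noteq> bot" "G \<le> F"
    "\<And>f::'a \<Rightarrow> real. continuous_on X f \<Longrightarrow> ((\<lambda>i. log_average T f (N i) (x i)) \<longlongrightarrow> integral\<^sup>L \<mu> f) G"
proof -
  \<comment> \<open>Tychonoff is applied to the product over all functions, so discontinuous ones,
    whose averages need not be bounded, get the value 0.\<close>
  define \<phi> where "\<phi> i f = (if continuous_on X f then log_average T f (N i) (x i) else 0)" for i and f :: "'a \<Rightarrow> real"
  have "\<exists>B. \<forall>i. \<bar>\<phi> i f\<bar> \<le> B" for f
  proof (cases "continuous_on X f")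
    case True
    then obtain B where "\<And>y. y \<in> X \<Longrightarrow> \<bar>f y\<bar> \<le> B" using bounded_continuous by blast
    then have "\<bar>\<phi> i f\<bar> \<le> B" for i
      using True by (simp add: \<phi>_def abs_log_average_le x)
    then show ?thesis by blast
  qed (auto simp: \<phi>_def)
  then obtain B where "\<And>f i. \<bar>\<phi> i f\<bar> \<le> B f" by metis
  from pointwise_cluster_filter[of F \<phi> B, OF \<open>F \<noteq> bot\<close> this]
  obtain G L where G: "G \<noteq> bot" "G \<le> F" and \<phi>: "\<And>f. ((\<lambda>i. \<phi> i f) \<longlongrightarrow> L f) G"
    by metis
  have L: "((\<lambda>i. log_average T f (N i) (x i)) \<longlongrightarrow> L f) G" if "continuous_on X f" for f
    using \<phi>[of f] that by (simp add: \<phi>_def)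
  have NG: "filterlim N at_top G"
    using N G(2) by (rule filterlim_mono[OF _ order_refl])
  interpret positive_functional X L
  proof
    fix f g :: "'a \<Rightarrow> real" and c :: real
    assume f: "continuous_on X f"
    show "L (\<lambda>x. c * f x) = c * L f"
      using L[of "\<lambda>x. c * f x"] tendsto_mult_left[OF L[OF f], of c] G(1) f
      by (intro tendsto_unique) (auto simp: log_average_cmult continuous_on_mult_left)
    assume g: "continuous_on X g"
    show "L (\<lambda>x. f x + g x) = L f + L g"
      using L[of "\<lambda>x. f x + g x"] tendsto_add[OF L[OF f] L[OF g]] G(1) f g
      by (intro tendsto_unique) (auto simp: log_average_add continuous_on_add)
    assume "\<And>x. x \<in> X \<Longrightarrow> f x \<le> g x"
    then show "L f \<le> L g"
      using log_average_mono x by (intro tendsto_le[OF G(1) L[OF g] L[OF f]] always_eventually) blast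
  next
    have "\<forall>\<^sub>F i in G. log_average T (\<lambda>x. 1) (N i) (x i) = 1"
      using eventually_compose_filterlim[OF eventually_gt_at_top[of 0] NG]
      by eventually_elim (simp add: log_average_const)
    then have "((\<lambda>i. log_average T (\<lambda>x. 1) (N i) (x i)) \<longlongrightarrow> 1) G"
      by (rule tendsto_eventually)
    then show "L (\<lambda>x. 1) = 1"
      using L[of "\<lambda>x. 1"] G(1) tendsto_unique by auto
  qed (rule compact)
  obtain \<mu> where sets: "sets \<mu> = sets (restrict_space borel X)" and prob: "prob_space \<mu>"
    and int: "\<And>f. continuous_on X f \<Longrightarrow> integral\<^sup>L \<mu> f = L f"
    using riesz_representation by blast
  interpret prob_space \<mu> by (fact prob)
  have L_T: "L (\<lambda>x. f (T x)) = L f" if f: "continuous_on X f" for f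
  proof -
    have fT: "continuous_on X (\<lambda>x. f (T x))"
      using continuous_on_compose_funpow[OF f, of 1] by simp
    obtain B where B: "\<And>y. y \<in> X \<Longrightarrow> \<bar>f y\<bar> \<le> B" using bounded_continuous[OF f] by blast
    have "((\<lambda>i. log_average T (\<lambda>y. f (T y)) (N i) (x i) - log_average T f (N i) (x i)) \<longlongrightarrow> 0) G"
    proof (rule Lim_null_comparison)
      show "\<forall>\<^sub>F i in G. norm (log_average T (\<lambda>y. f (T y)) (N i) (x i) - log_average T f (N i) (x i))
          \<le> 2 * B / harm (N i)"
        by (intro always_eventually allI) (simp add: log_average_shift_diff_le[where f = f] B x)
      have "filterlim (\<lambda>i. harm (N i) :: real) at_infinity G"
        by (intro filterlim_at_top_imp_at_infinity filterlim_compose[OF harm_at_top NG])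
      then show "((\<lambda>i. 2 * B / harm (N i)) \<longlongrightarrow> 0) G"
        by (rule tendsto_divide_0[OF tendsto_const])
    qed
    with tendsto_diff[OF L[OF fT] L[OF f]] have "L (\<lambda>x. f (T x)) - L f = 0"
      using G(1) by (rule tendsto_unique[rotated])
    then show ?thesis by simp
  qed
  note T_meas = measurable_T[OF sets]
  \<comment> \<open>By \<open>L_T\<close> the push-forward and \<open>\<mu>\<close> give continuous
    functions the same integrals, so they coincide; invariance on sets is read off from
    this.\<close>
  have "distr \<mu> (restrict_space borel X) T = \<mu>"
  proof (rule prob_measure_eqI_continuous[OF compact _ _ sets prob])
    show "prob_space (distr \<mu> (restrict_space borel X) T)"
      by (rule prob_space_distr[OF T_meas])
    fix f :: "'a \<Rightarrow> real" assume f: "continuous_on X f"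
    have fT: "continuous_on X (\<lambda>x. f (T x))"
      using continuous_on_compose_funpow[OF f, of 1] by simp
    show "integral\<^sup>L (distr \<mu> (restrict_space borel X) T) f = integral\<^sup>L \<mu> f"
      by (subst integral_distr[OF T_meas borel_measurable_continuous_on_restrict[OF f]])
        (simp add: int[OF fT] int[OF f] L_T[OF f])
  qed simp
  then have "emeasure \<mu> (T -` A \<inter> X) = emeasure \<mu> A" if "A \<in> sets \<mu>" for A
    using emeasure_distr[OF T_meas, of A] that sets_eq_imp_space_eq[OF sets]
    by (simp add: sets space_restrict_space)
  then have "\<mu> \<in> invariant_prob_measures X T"
    by (simp add: invariant_prob_measures_def sets prob)
  then show ?thesis
    by (rule that[OF _ G]) (simp add: int L)
qed

section \<open>Unique ergodicity and convergence of averages\<close>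

lemma integral_log_average:
  fixes f :: "'a \<Rightarrow> real"
  assumes \<mu>: "\<mu> \<in> invariant_prob_measures X T" and f: "continuous_on X f" and "0 < n"
  shows "integral\<^sup>L \<mu> (log_average T f n) = integral\<^sup>L \<mu> f"
proof -
  have sets: "sets \<mu> = sets (restrict_space borel X)" and prob: "prob_space \<mu>"
    and inv: "\<And>A. A \<in> sets \<mu> \<Longrightarrow> emeasure \<mu> (T -` A \<inter> X) = emeasure \<mu> A"
    using \<mu> by (auto simp: invariant_prob_measures_def)
  note T_meas = measurable_T[OF sets]
  have X: "space \<mu> = X"
    using sets_eq_imp_space_eq[OF sets] by (simp add: space_restrict_space)
  have distr: "distr \<mu> (restrict_space borel X) T = \<mu>"
  proof (rule measure_eqI)
    show "emeasure (distr \<mu> (restrict_space borel X) T) A = emeasure \<mu> A"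
      if "A \<in> sets (distr \<mu> (restrict_space borel X) T)" for A
      using that emeasure_distr[OF T_meas, of A] inv[of A] by (simp add: X sets)
  qed (simp add: sets)
  have "integral\<^sup>L \<mu> (\<lambda>x. f ((T ^^ k) x)) = integral\<^sup>L \<mu> f" for k
  proof (induction k)
    case (Suc k)
    have "integral\<^sup>L \<mu> (\<lambda>x. f ((T ^^ k) x)) = integral\<^sup>L (distr \<mu> (restrict_space borel X) T) (\<lambda>x. f ((T ^^ k) x))"
      by (simp add: distr)
    also have "\<dots> = integral\<^sup>L \<mu> (\<lambda>x. f ((T ^^ k) (T x)))"
      by (rule integral_distr[OF T_meas borel_measurable_continuous_on_restrict[OF continuous_on_compose_funpow[OF f]]])
    finally show ?case using Suc by (simp add: funpow_swap1)
  qed simp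
  \<comment> \<open>Averaging a constant does not depend on the base point, so
    \<open>undefined\<close> serves as one.\<close>
  then have "integral\<^sup>L \<mu> (log_average T f n) = log_average T (\<lambda>_. integral\<^sup>L \<mu> f) n undefined"
    unfolding log_average_def
    by (simp add: Bochner_Integration.integral_sum integrable_continuous_on_compact[OF prob sets compact]
        continuous_on_compose_funpow[OF f])
  then show ?thesis using \<open>0 < n\<close> by (simp add: log_average_const)
qed

lemma continuous_on_log_average:
  fixes f :: "'a \<Rightarrow> real"
  shows "continuous_on X f \<Longrightarrow> continuous_on X (log_average T f n)"
  unfolding log_average_def by (intro continuous_intros continuous_on_compose_funpow)

lemma integral_eq_limit_log_average:
  fixes f :: "'a \<Rightarrow> real"
  assumes \<mu>: "\<mu> \<in> invariant_prob_measures X T" and f: "continuous_on X f"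
    and lim: "\<And>x. x \<in> X \<Longrightarrow> (\<lambda>n. log_average T f n x) \<longlonglongrightarrow> c"
  shows "integral\<^sup>L \<mu> f = c"
proof -
  have sets: "sets \<mu> = sets (restrict_space borel X)" and prob: "prob_space \<mu>"
    using \<mu> by (auto simp: invariant_prob_measures_def)
  interpret prob_space \<mu> by (fact prob)
  have X: "space \<mu> = X"
    using sets_eq_imp_space_eq[OF sets] by (simp add: space_restrict_space)
  note int = integrable_continuous_on_compact[OF prob sets compact]
  obtain B where B: "\<And>y. y \<in> X \<Longrightarrow> \<bar>f y\<bar> \<le> B" using bounded_continuous[OF f] by blast
  have "(\<lambda>n. integral\<^sup>L \<mu> (log_average T f n)) \<longlonglongrightarrow> integral\<^sup>L \<mu> (\<lambda>x. c)"
    by (rule integral_dominated_convergence[where w = "\<lambda>x. B"])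
      (auto simp: X lim abs_log_average_le[OF B]
        intro!: AE_I2 borel_measurable_integrable[OF int] continuous_on_log_average f)
  \<comment> \<open>The integrals are shown to be constant in \<open>n\<close> from
    \<open>n = 1\<close> on; at \<open>n = 0\<close> the average is 0.\<close>
  moreover have "(\<lambda>n. integral\<^sup>L \<mu> (log_average T f n)) \<longlonglongrightarrow> integral\<^sup>L \<mu> f"
    by (intro tendsto_eventually eventually_mono[OF eventually_gt_at_top[of 0]] integral_log_average[OF \<mu> f])
  ultimately have "integral\<^sup>L \<mu> (\<lambda>x. c) = integral\<^sup>L \<mu> f"
    by (rule LIMSEQ_unique)
  then show ?thesis
    by (simp add: prob_space)
qed

text \<open>Every invariant measure integrates \<open>f\<close> to the pointwise limit, which
  depends on \<open>f\<close> alone, so any two agree. Existence comes from the averages along a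
  single orbit.\<close>

lemma uniquely_ergodic_if_log_average_converges:
  assumes "\<And>f::'a \<Rightarrow> real. continuous_on X f \<Longrightarrow> \<exists>c. \<forall>x\<in>X. (\<lambda>n. log_average T f n x) \<longlonglongrightarrow> c"
  shows "uniquely_ergodic X T"
proof -
  obtain x where x: "x \<in> X" using nonempty by blast
  obtain \<mu> where \<mu>: "\<mu> \<in> invariant_prob_measures X T"
    by (rule krylov_bogoliubov[OF trivial_limit_sequentially filterlim_ident, of "\<lambda>_. x", OF x]) (rule that)
  have "\<nu> = \<mu>" if \<nu>: "\<nu> \<in> invariant_prob_measures X T" for \<nu>
  proof (rule prob_measure_eqI_continuous[OF compact])
    fix f :: "'a \<Rightarrow> real" assume f: "continuous_on X f"
    obtain c where "\<And>x. x \<in> X \<Longrightarrow> (\<lambda>n. log_average T f n x) \<longlonglongrightarrow> c"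
      using assms[OF f] by blast
    then show "integral\<^sup>L \<nu> f = integral\<^sup>L \<mu> f"
      using integral_eq_limit_log_average[OF \<mu> f] integral_eq_limit_log_average[OF \<nu> f] by metis
  qed (use \<mu> \<nu> in \<open>auto simp: invariant_prob_measures_def\<close>)
  with \<mu> show ?thesis
    unfolding uniquely_ergodic_def is_singleton_def by blast
qed

text \<open>If uniformity fails, bad points at arbitrarily large lengths produce an invariant
  \<open>\<nu>\<close> whose integral of \<open>f\<close> is at distance at least \<open>e\<close>
  from that of \<open>\<mu>\<close>, contradicting \<open>\<nu> = \<mu>\<close>.\<close>

lemma uniquely_ergodic_imp_uniform_limit:
  fixes f :: "'a \<Rightarrow> real"
  assumes ue: "uniquely_ergodic X T" and \<mu>: "\<mu> \<in> invariant_prob_measures X T" and f: "continuous_on X f"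
  shows "uniform_limit X (\<lambda>n. log_average T f n) (\<lambda>x. integral\<^sup>L \<mu> f) sequentially"
proof (rule ccontr)
  assume "\<not> uniform_limit X (\<lambda>n. log_average T f n) (\<lambda>x. integral\<^sup>L \<mu> f) sequentially"
  then obtain e where e: "0 < e"
    and "\<forall>i. \<exists>n\<ge>i. \<exists>x\<in>X. e \<le> dist (log_average T f n x) (integral\<^sup>L \<mu> f)"
    unfolding uniform_limit_sequentially_iff by (meson not_le)
  then obtain N x where N: "\<And>i. i \<le> N i" and x: "\<And>i. x i \<in> X"
    and far: "\<And>i. e \<le> dist (log_average T f (N i) (x i)) (integral\<^sup>L \<mu> f)"
    by metis
  have "filterlim N at_top sequentially"
    by (rule filterlim_at_top_mono[OF filterlim_ident]) (simp add: N)
  then obtain \<nu> G where \<nu>: "\<nu> \<in> invariant_prob_measures X T" and G: "G \<noteq> bot"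
    and lim: "((\<lambda>i. log_average T f (N i) (x i)) \<longlongrightarrow> integral\<^sup>L \<nu> f) G"
    by (rule krylov_bogoliubov[of sequentially N x, OF trivial_limit_sequentially _ x]) (use f that in blast)
  have "\<nu> = \<mu>"
    using ue \<mu> \<nu> unfolding uniquely_ergodic_def is_singleton_def by auto
  with lim e have "\<forall>\<^sub>F i in G. dist (log_average T f (N i) (x i)) (integral\<^sup>L \<mu> f) < e"
    by (auto simp: tendsto_iff)
  with G far show False
    by (metis (mono_tags, lifting) eventually_False eventually_mono not_le)
qed

lemma uniform_limit_log_window_average:
  assumes "uniform_limit X (\<lambda>n. log_average T f n) (\<lambda>x. c) sequentially"
  shows "uniform_limit X (\<lambda>(m, n). log_window_average T f m n) (\<lambda>x. c) gap_at_top"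
  unfolding uniform_limit_iff eventually_gap_at_top
proof (intro allI impI)
  fix e :: real assume "0 < e"
  \<comment> \<open>The threshold is uniform over \<open>X\<close>, so it applies at
    \<open>(T ^^ m) x\<close> with length \<open>n - m\<close>, whatever \<open>m\<close>
    is.\<close>
  with assms obtain N where "\<And>n x. N \<le> n \<Longrightarrow> x \<in> X \<Longrightarrow> dist (log_average T f n x) c < e"
    unfolding uniform_limit_sequentially_iff by blast
  then show "\<exists>N. \<forall>m n. m < n \<and> N \<le> n - m \<longrightarrow>
      (\<forall>x\<in>X. dist ((case (m, n) of (m, n) \<Rightarrow> log_window_average T f m n) x) c < e)"
    by (intro exI[of _ N]) (auto simp: log_window_average_eq funpow_in)
qed

end

section \<open>Comparing the modes of convergence\<close>

lemma tendsto_log_average_if_window: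
  assumes "((\<lambda>(m, n). log_window_average T f m n x) \<longlongrightarrow> c) gap_at_top"
  shows "(\<lambda>n. log_average T f n x) \<longlonglongrightarrow> c"
proof (rule LIMSEQ_I)
  fix e :: real assume "0 < e"
  with assms obtain N where N: "\<And>m n. m < n \<Longrightarrow> N \<le> n - m \<Longrightarrow> \<bar>log_window_average T f m n x - c\<bar> < e"
    unfolding tendsto_gap_at_top_iff by blast
  \<comment> \<open>Windows starting at \<open>m = 0\<close> are plain averages;
    \<open>max 1 N\<close> secures \<open>0 < n\<close>.\<close>
  have "norm (log_average T f n x - c) < e" if "max 1 N \<le> n" for n
    using N[of 0 n] that by (simp add: log_window_average_eq)
  then show "\<exists>N. \<forall>n\<ge>N. norm (log_average T f n x - c) < e" by blast
qed

lemma tendsto_window_if_uniform: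
  assumes "uniform_limit X (\<lambda>(m, n). log_window_average T f m n) (\<lambda>x. c) gap_at_top" "x \<in> X"
  shows "((\<lambda>(m, n). log_window_average T f m n x) \<longlongrightarrow> c) gap_at_top"
  using tendsto_uniform_limitI[OF assms] by (simp add: case_prod_unfold)

theorem theorem2p15:
  fixes X :: "'a::metric_space set" and T :: "'a \<Rightarrow> 'a"
  assumes "topological_dynamical_system X T"
  shows
    "(uniquely_ergodic X T \<longleftrightarrow>
       (\<exists>\<mu>\<in>invariant_prob_measures X T. \<forall>f::'a \<Rightarrow> real. continuous_on X f \<longrightarrow>
         (\<forall>x\<in>X. ((\<lambda>(m, n). log_window_average T f m n x) \<longlongrightarrow> (\<integral>y. f y \<partial>\<mu>)) gap_at_top))) \<and>
     (uniquely_ergodic X T \<longleftrightarrow>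
       (\<exists>\<mu>\<in>invariant_prob_measures X T. \<forall>f::'a \<Rightarrow> real. continuous_on X f \<longrightarrow>
         (\<forall>x\<in>X. (\<lambda>n. log_average T f n x) \<longlonglongrightarrow> (\<integral>y. f y \<partial>\<mu>)))) \<and>
     (uniquely_ergodic X T \<longleftrightarrow>
       (\<forall>f::'a \<Rightarrow> real. continuous_on X f \<longrightarrow>
         (\<exists>c. \<forall>x\<in>X. (\<lambda>n. log_average T f n x) \<longlonglongrightarrow> c))) \<and>
     (uniquely_ergodic X T \<longleftrightarrow>
       (\<forall>f::'a \<Rightarrow> real. continuous_on X f \<longrightarrow>
         (\<exists>c. \<forall>x\<in>X. ((\<lambda>(m, n). log_window_average T f m n x) \<longlongrightarrow> c) gap_at_top))) \<and>
     (uniquely_ergodic X T \<longleftrightarrow>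
       (\<forall>f::'a \<Rightarrow> real. continuous_on X f \<longrightarrow>
         (\<exists>c. uniform_limit X (\<lambda>n. log_average T f n) (\<lambda>x. c) sequentially))) \<and>
     (uniquely_ergodic X T \<longleftrightarrow>
       (\<forall>f::'a \<Rightarrow> real. continuous_on X f \<longrightarrow>
         (\<exists>c. uniform_limit X (\<lambda>(m, n). log_window_average T f m n) (\<lambda>x. c) gap_at_top)))"
proof -
  interpret topological_dynamical_system X T by fact
  define PA where "PA f c \<longleftrightarrow> (\<forall>x\<in>X. (\<lambda>n. log_average T f n x) \<longlonglongrightarrow> c)" for f c
  define PW where "PW f c \<longleftrightarrow> (\<forall>x\<in>X. ((\<lambda>(m, n). log_window_average T f m n x) \<longlongrightarrow> c) gap_at_top)" for f c
  define UA where "UA f c \<longleftrightarrow> uniform_limit X (\<lambda>n. log_average T f n) (\<lambda>x. c) sequentially" for f c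
  define UW where "UW f c \<longleftrightarrow> uniform_limit X (\<lambda>(m, n). log_window_average T f m n) (\<lambda>x. c) gap_at_top" for f c
  have UA_UW: "UW f c" if "UA f c" for f c
    using that unfolding UA_def UW_def by (rule uniform_limit_log_window_average)
  have UA_PA: "PA f c" if "UA f c" for f c
    using that unfolding UA_def PA_def by (intro ballI) (rule tendsto_uniform_limitI)
  have UW_PW: "PW f c" if "UW f c" for f c
    using that unfolding UW_def PW_def by (intro ballI) (rule tendsto_window_if_uniform)
  have PW_PA: "PA f c" if "PW f c" for f c
    unfolding PA_def
  proof
    fix x assume "x \<in> X"
    with that have "((\<lambda>(m, n). log_window_average T f m n x) \<longlongrightarrow> c) gap_at_top"
      unfolding PW_def by (rule bspec)
    then show "(\<lambda>n. log_average T f n x) \<longlonglongrightarrow> c"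
      by (rule tendsto_log_average_if_window)
  qed
  have ue_if_PA: "uniquely_ergodic X T" if "\<forall>f. continuous_on X f \<longrightarrow> (\<exists>c. PA f c)"
  proof (rule uniquely_ergodic_if_log_average_converges)
    fix f :: "'a \<Rightarrow> real" assume "continuous_on X f"
    with that have "\<exists>c. PA f c" by blast
    then show "\<exists>c. \<forall>x\<in>X. (\<lambda>n. log_average T f n x) \<longlonglongrightarrow> c" unfolding PA_def .
  qed
  \<comment> \<open>The limits are recorded as integrals against one measure for all
    \<open>f\<close>, because two of the conditions name such a measure rather than just some
    constant.\<close>
  have UA_if_ue: "\<exists>\<mu>\<in>invariant_prob_measures X T. \<forall>f. continuous_on X f \<longrightarrow> UA f (integral\<^sup>L \<mu> f)"
    if ue: "uniquely_ergodic X T"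
  proof -
    from ue obtain \<mu> where \<mu>: "\<mu> \<in> invariant_prob_measures X T"
      by (auto simp: uniquely_ergodic_def is_singleton_def)
    show ?thesis
      unfolding UA_def using \<mu>
      by (intro bexI[of _ \<mu>] allI impI uniquely_ergodic_imp_uniform_limit[OF ue])
  qed
  \<comment> \<open>Unique ergodicity gives \<open>UA\<close>, from which every other mode follows;
    each mode in turn gives \<open>PA\<close> with some constant for every continuous
    \<open>f\<close>, hence unique ergodicity.\<close>
  show ?thesis
    unfolding PA_def[symmetric] PW_def[symmetric] UA_def[symmetric] UW_def[symmetric]
    using ue_if_PA UA_if_ue UA_UW UA_PA UW_PW PW_PA by (intro conjI iffI; meson)
qed

end
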